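(* (1) For each fixed randomness constant $c\in\omega$, the family of all $\Pi^0_1$ classes containing only reals that are Martin-Löf random with respect to the randomness constant $c$ is effectively enumerable. (2) The family of all $\Sigma^0_2$ classes containing only Martin-Löf random reals is effectively enumerable.
   Context: $K$ denotes prefix-free Kolmogorov complexity (with respect to a fixed universal prefix-free machine). A real $x\in 2^\omega$ is Martin-Löf random with respect to the randomness constant $c$ if $K(x\upharpoonright n)\ge n-c$ for all $n$; by Schnorr's Theorem, $x$ is Martin-Löf random if and only if this holds for some $c$. A $\Pi^0_1$ class is the set $[T]=\{X\in 2^\omega : \forall n\; X\upharpoonright n\in T\}$ of infinite paths through a computable tree $T\subseteq 2^{<\omega}$ (a set of strings closed under prefixes). A $\Sigma^0_2$ class is a lightface $\Sigma^0_2$ subset of $2^\omega$. A family $\mathcal{C}$ of $\Pi^0_1$ (respectively $\Sigma^0_2$) classes is effectively enumerable if there is a $\Pi^0_1$ (respectively $\Sigma^0_2$) set $S\subseteq 2^\omega\times\omega$ such that $\mathcal{C}=\{\{X : (X,e)\in S\} : e\in\omega\}$. *)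

theory Defs
  imports "HOL-Library.Nat_Bijection" "HOL-Library.Sublist" "HOL-Library.Extended_Nat"
begin

section \<open>Partial recursive functions\<close>

definition primrec_step ::
  "(nat \<Rightarrow> nat option) \<Rightarrow> (nat \<Rightarrow> nat option) \<Rightarrow> nat \<Rightarrow> nat \<Rightarrow> nat option" where
  "primrec_step f g a k =
     rec_nat (f a) (\<lambda>i r. Option.bind r (\<lambda>v. g (prod_encode (a, prod_encode (i, v))))) k"

text \<open>The search diverges unless \<open>f\<close> is defined at every argument tried before the first zero.\<close>

definition minimization :: "(nat \<Rightarrow> nat option) \<Rightarrow> nat \<Rightarrow> nat option" where
  "minimization f a =
     (if \<exists>k. f (prod_encode (a, k)) = Some 0 \<and> (\<forall>j<k. \<exists>v. f (prod_encode (a, j)) = Some (Suc v))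
      then Some (LEAST k. f (prod_encode (a, k)) = Some 0)
      else None)"

text \<open>
  The usual schemes, with several arguments passed as one number through the
  (Cantor) pairing bijection \<open>prod_encode\<close>; undefinedness is \<open>None\<close>.
\<close>

inductive partial_recursive :: "(nat \<Rightarrow> nat option) \<Rightarrow> bool" where
  zero: "partial_recursive (\<lambda>n. Some 0)"
| succ: "partial_recursive (\<lambda>n. Some (Suc n))"
| left: "partial_recursive (\<lambda>n. Some (fst (prod_decode n)))"
| right: "partial_recursive (\<lambda>n. Some (snd (prod_decode n)))"
| pair: "partial_recursive f \<Longrightarrow> partial_recursive g \<Longrightarrow>
    partial_recursive
      (\<lambda>n. Option.bind (f n) (\<lambda>u. Option.bind (g n) (\<lambda>v. Some (prod_encode (u, v)))))"
| comp: "partial_recursive f \<Longrightarrow> partial_recursive g \<Longrightarrow>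
    partial_recursive (\<lambda>n. Option.bind (g n) f)"
| prim: "partial_recursive f \<Longrightarrow> partial_recursive g \<Longrightarrow>
    partial_recursive (\<lambda>n. primrec_step f g (fst (prod_decode n)) (snd (prod_decode n)))"
| mini: "partial_recursive f \<Longrightarrow> partial_recursive (minimization f)"

text \<open>
  Computability over other domains is relative to a coding \<open>enc\<close> into the natural numbers.
  The coding need not be surjective: the witness \<open>f\<close> is unconstrained off the range of \<open>enc\<close>.
\<close>

definition computable_pred :: "('a \<Rightarrow> nat) \<Rightarrow> ('a \<Rightarrow> bool) \<Rightarrow> bool" where
  "computable_pred enc P \<longleftrightarrow>
     (\<exists>f. partial_recursive f \<and> (\<forall>x. f (enc x) = Some (of_bool (P x))))"

definition partial_computable ::
  "('a \<Rightarrow> nat) \<Rightarrow> ('b \<Rightarrow> nat) \<Rightarrow> ('a \<Rightarrow> 'b option) \<Rightarrow> bool" where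
  "partial_computable enc enc' M \<longleftrightarrow>
     (\<exists>f. partial_recursive f \<and> (\<forall>x. f (enc x) = map_option enc' (M x)))"

section \<open>Strings and reals\<close>

type_synonym real_seq = "nat \<Rightarrow> bool"

definition string_code :: "bool list \<Rightarrow> nat" where
  "string_code \<sigma> = list_encode (map of_bool \<sigma>)"

definition restr :: "real_seq \<Rightarrow> nat \<Rightarrow> bool list"  (infix \<open>\<restriction>\<close> 90) where
  "X \<restriction> n = map X [0..<n]"

section \<open>Prefix-free complexity and randomness\<close>

definition prefix_free_machine :: "(bool list \<Rightarrow> bool list option) \<Rightarrow> bool" where
  "prefix_free_machine M \<longleftrightarrow>
     partial_computable string_code string_code M \<and>
     (\<forall>\<sigma>\<in>dom M. \<forall>\<tau>\<in>dom M. prefix \<sigma> \<tau> \<longrightarrow> \<sigma> = \<tau>)"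

definition universal_prefix_free_machine :: "(bool list \<Rightarrow> bool list option) \<Rightarrow> bool" where
  "universal_prefix_free_machine U \<longleftrightarrow>
     prefix_free_machine U \<and>
     (\<forall>M. prefix_free_machine M \<longrightarrow> (\<exists>\<rho>. \<forall>\<sigma>. U (\<rho> @ \<sigma>) = M \<sigma>))"

text \<open>The value is \<open>\<infinity>\<close> when \<open>\<tau>\<close> is not in the range of \<open>U\<close>, which cannot happen if \<open>U\<close> is universal.\<close>

definition K :: "(bool list \<Rightarrow> bool list option) \<Rightarrow> bool list \<Rightarrow> enat" where
  "K U \<tau> = (INF \<sigma>\<in>{\<sigma>. U \<sigma> = Some \<tau>}. enat (length \<sigma>))"

text \<open>The inequality \<open>K(X \<restriction> n) \<ge> n - c\<close>, written without subtraction.\<close>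

definition ml_random_const ::
  "(bool list \<Rightarrow> bool list option) \<Rightarrow> nat \<Rightarrow> real_seq \<Rightarrow> bool" where
  "ml_random_const U c X \<longleftrightarrow> (\<forall>n. enat n \<le> K U (X \<restriction> n) + enat c)"

text \<open>By Schnorr's theorem this agrees with passing every Martin-L\<ouml>f test; it does not depend on \<open>U\<close>.\<close>

definition ml_random :: "(bool list \<Rightarrow> bool list option) \<Rightarrow> real_seq \<Rightarrow> bool" where
  "ml_random U X \<longleftrightarrow> (\<exists>c. ml_random_const U c X)"

section \<open>Effective classes and their enumerations\<close>

definition computable_tree :: "bool list set \<Rightarrow> bool" where
  "computable_tree T \<longleftrightarrow>
     (\<forall>\<tau>\<in>T. \<forall>\<sigma>. prefix \<sigma> \<tau> \<longrightarrow> \<sigma> \<in> T) \<and> computable_pred string_code (\<lambda>\<sigma>. \<sigma> \<in> T)"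

definition paths :: "bool list set \<Rightarrow> real_seq set" where
  "paths T = {X. \<forall>n. X \<restriction> n \<in> T}"

definition Pi01_class :: "real_seq set \<Rightarrow> bool" where
  "Pi01_class P \<longleftrightarrow> (\<exists>T. computable_tree T \<and> P = paths T)"

text \<open>
  For the remaining lightface classes: the standard normal forms with a computable
  matrix that reads the real only through a finite initial segment.
\<close>

definition Sigma02_class :: "real_seq set \<Rightarrow> bool" where
  "Sigma02_class A \<longleftrightarrow>
     (\<exists>R. computable_pred (\<lambda>(\<sigma>, m). prod_encode (string_code \<sigma>, m)) R \<and>
          A = {X. \<exists>m. \<forall>n. R (X \<restriction> n, m)})"

definition Pi01_set :: "(real_seq \<times> nat) set \<Rightarrow> bool" where
  "Pi01_set S \<longleftrightarrow>
     (\<exists>R. computable_pred (\<lambda>(\<sigma>, e). prod_encode (string_code \<sigma>, e)) R \<and>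
          S = {(X, e). \<forall>n. R (X \<restriction> n, e)})"

definition Sigma02_set :: "(real_seq \<times> nat) set \<Rightarrow> bool" where
  "Sigma02_set S \<longleftrightarrow>
     (\<exists>R. computable_pred
            (\<lambda>(\<sigma>, m, e). prod_encode (string_code \<sigma>, prod_encode (m, e))) R \<and>
          S = {(X, e). \<exists>m. \<forall>n. R (X \<restriction> n, m, e)})"

definition effectively_enumerable_Pi01 :: "real_seq set set \<Rightarrow> bool" where
  "effectively_enumerable_Pi01 C \<longleftrightarrow>
     (\<exists>S. Pi01_set S \<and> C = range (\<lambda>e. {X. (X, e) \<in> S}))"

definition effectively_enumerable_Sigma02 :: "real_seq set set \<Rightarrow> bool" where
  "effectively_enumerable_Sigma02 C \<longleftrightarrow>
     (\<exists>S. Sigma02_set S \<and> C = range (\<lambda>e. {X. (X, e) \<in> S}))"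

end

theory Submission
  imports Defs
begin

text \<open>
  A derivation of \<open>e(x) = y\<close> is a finite list of evaluation facts, each justified by later entries, so
  checking a coded derivation is recursive and the evaluation relation is uniformly recursively
  enumerable. This yields universal matrices for \<open>\<Pi>\<^sup>0\<^sub>1\<close> and \<open>\<Sigma>\<^sup>0\<^sub>2\<close> classes. Since the reals random
  with constant \<open>c\<close> form a \<open>\<Pi>\<^sup>0\<^sub>1\<close> class uniformly in \<open>c\<close>, intersecting the \<open>e\<close>-th \<open>\<Pi>\<^sup>0\<^sub>1\<close> class with that
  class, respectively the \<open>e\<close>-th \<open>\<Sigma>\<^sup>0\<^sub>2\<close> class with the union of these classes over all \<open>c\<close>, leaves
  every class in the family unchanged and puts every other class into it.
\<close>

section \<open>Total recursive functions and relations\<close>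

definition pfst :: "nat \<Rightarrow> nat" where "pfst n = fst (prod_decode n)"
definition psnd :: "nat \<Rightarrow> nat" where "psnd n = snd (prod_decode n)"

lemma pfst_prod_encode [simp]: "pfst (prod_encode (a, b)) = a"
  by (simp add: pfst_def)

lemma psnd_prod_encode [simp]: "psnd (prod_encode (a, b)) = b"
  by (simp add: psnd_def)

lemma prod_encode_pfst_psnd [simp]: "prod_encode (pfst n, psnd n) = n"
  by (simp add: pfst_def psnd_def)

definition recursive_fun :: "(nat \<Rightarrow> nat) \<Rightarrow> bool" where
  "recursive_fun f \<longleftrightarrow> partial_recursive (\<lambda>n. Some (f n))"

definition recursive_rel :: "(nat \<Rightarrow> bool) \<Rightarrow> bool" where
  "recursive_rel P \<longleftrightarrow> recursive_fun (\<lambda>n. of_bool (P n))"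

lemma recursive_fun_comp:
  assumes "recursive_fun f" "recursive_fun g"
  shows "recursive_fun (\<lambda>n. f (g n))"
  using partial_recursive.comp[OF assms[unfolded recursive_fun_def]]
  by (simp add: recursive_fun_def)

lemma recursive_fun_Suc: "recursive_fun f \<Longrightarrow> recursive_fun (\<lambda>n. Suc (f n))"
  using recursive_fun_comp[of Suc f] partial_recursive.succ by (simp add: recursive_fun_def)

lemma recursive_fun_pfst: "recursive_fun f \<Longrightarrow> recursive_fun (\<lambda>n. pfst (f n))"
  using recursive_fun_comp[of pfst f] partial_recursive.left
  by (simp add: recursive_fun_def pfst_def)

lemma recursive_fun_psnd: "recursive_fun f \<Longrightarrow> recursive_fun (\<lambda>n. psnd (f n))"
  using recursive_fun_comp[of psnd f] partial_recursive.right
  by (simp add: recursive_fun_def psnd_def)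

lemma recursive_fun_prod_encode:
  assumes "recursive_fun f" "recursive_fun g"
  shows "recursive_fun (\<lambda>n. prod_encode (f n, g n))"
  using partial_recursive.pair[OF assms[unfolded recursive_fun_def]]
  by (simp add: recursive_fun_def)

lemma recursive_fun_id: "recursive_fun (\<lambda>n. n)"
  using partial_recursive.pair[OF partial_recursive.left partial_recursive.right]
  by (simp add: recursive_fun_def)

lemma recursive_fun_const: "recursive_fun (\<lambda>n. c)"
proof (induction c)
  case 0
  show ?case by (simp add: recursive_fun_def partial_recursive.zero)
next
  case (Suc c)
  then show ?case by (rule recursive_fun_Suc)
qed

text \<open>The parameter \<open>n\<close> itself is the first component of the pair handed to
  \<open>prim\<close>, so base, step and bound may all depend on it.\<close>

lemma recursive_fun_rec_nat:
  assumes "recursive_fun f"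
    and "recursive_fun (\<lambda>z. g (pfst z) (pfst (psnd z)) (psnd (psnd z)))"
    and "recursive_fun h"
  shows "recursive_fun (\<lambda>n. rec_nat (f n) (g n) (h n))"
proof -
  let ?f = "\<lambda>n. Some (f n)"
  let ?g = "\<lambda>z. Some (g (pfst z) (pfst (psnd z)) (psnd (psnd z)))"
  have "primrec_step ?f ?g a k = Some (rec_nat (f a) (g a) k)" for a k
    by (induction k) (simp_all add: primrec_step_def)
  then have "recursive_fun (\<lambda>z. rec_nat (f (pfst z)) (g (pfst z)) (psnd z))"
    using partial_recursive.prim[OF assms(1,2)[unfolded recursive_fun_def]]
    by (simp add: recursive_fun_def pfst_def psnd_def)
  from recursive_fun_comp[OF this recursive_fun_prod_encode[OF recursive_fun_id assms(3)]]
  show ?thesis by simp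
qed

lemmas recursive_basic =
  recursive_fun_Suc recursive_fun_pfst recursive_fun_psnd recursive_fun_prod_encode
  recursive_fun_id recursive_fun_const recursive_fun_rec_nat

section \<open>Arithmetic, case distinction and bounded quantification\<close>

lemma recursive_fun_pred: "recursive_fun f \<Longrightarrow> recursive_fun (\<lambda>n. f n - 1)"
proof -
  assume f: "recursive_fun f"
  have "f n - 1 = rec_nat 0 (\<lambda>i r. i) (f n)" for n
    by (cases "f n") simp_all
  then show ?thesis
    by (simp only:) (intro recursive_basic f)
qed

lemma recursive_fun_diff:
  assumes f: "recursive_fun f" and g: "recursive_fun g"
  shows "recursive_fun (\<lambda>n. f n - g n)"
proof -
  have diff: "a - b = rec_nat a (\<lambda>i r. r - 1) b" for a b :: nat
    by (induction b) simp_all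
  have "(\<lambda>n. f n - g n) = (\<lambda>n. rec_nat (f n) (\<lambda>i r. r - 1) (g n))"
    by (rule ext) (rule diff)
  then show ?thesis
    by (simp only:) (intro recursive_basic recursive_fun_pred f g)
qed

lemma recursive_fun_add:
  assumes f: "recursive_fun f" and g: "recursive_fun g"
  shows "recursive_fun (\<lambda>n. f n + g n)"
proof -
  have "a + b = rec_nat a (\<lambda>i r. Suc r) b" for a b :: nat
    by (induction b) simp_all
  then show ?thesis
    by (simp only:) (intro recursive_basic f g)
qed

lemma recursive_fun_if:
  assumes "recursive_rel P" and f: "recursive_fun f" and g: "recursive_fun g"
  shows "recursive_fun (\<lambda>n. if P n then f n else g n)"
proof -
  \<comment> \<open>A recursion of length 0 or 1 makes the case distinction: its one step replaces
    \<open>g n\<close> by \<open>f n\<close>.\<close>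
  have "(if P n then f n else g n) = rec_nat (g n) (\<lambda>i r. f n) (of_bool (P n))" for n
    by simp
  then show ?thesis
    using assms(1) unfolding recursive_rel_def
    by (simp only:) (intro recursive_basic f g recursive_fun_comp[OF f])
qed

lemma recursive_rel_eq:
  assumes f: "recursive_fun f" and g: "recursive_fun g"
  shows "recursive_rel (\<lambda>n. f n = g n)"
proof -
  \<comment> \<open>Subtraction is truncated, so the sum of both differences is the distance, which
    is zero exactly at equality.\<close>
  have "of_bool (a = b) = 1 - ((a - b) + (b - a))" for a b :: nat
    by auto
  then show ?thesis
    unfolding recursive_rel_def
    by (simp only:) (intro recursive_basic recursive_fun_diff recursive_fun_add f g)
qed

lemma recursive_rel_le:
  assumes f: "recursive_fun f" and g: "recursive_fun g"
  shows "recursive_rel (\<lambda>n. f n \<le> g n)"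
proof -
  have "(\<lambda>n. f n \<le> g n) = (\<lambda>n. f n - g n = 0)"
    by auto
  then show ?thesis
    by (simp only:) (intro recursive_rel_eq recursive_basic recursive_fun_diff f g)
qed

lemma recursive_rel_not: "recursive_rel P \<Longrightarrow> recursive_rel (\<lambda>n. \<not> P n)"
  using recursive_rel_eq[OF _ recursive_fun_const[of 0], of "\<lambda>n. of_bool (P n)"]
  by (simp add: recursive_rel_def)

lemma recursive_rel_conj:
  assumes "recursive_rel P" "recursive_rel Q"
  shows "recursive_rel (\<lambda>n. P n \<and> Q n)"
proof -
  have "(\<lambda>n. of_bool (P n \<and> Q n)) = (\<lambda>n. if P n then of_bool (Q n) else (0::nat))"
    by auto
  then show ?thesis
    using assms recursive_fun_if[OF assms(1) _ recursive_fun_const[of 0]]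
    unfolding recursive_rel_def by simp
qed

lemma recursive_rel_disj:
  assumes "recursive_rel P" "recursive_rel Q"
  shows "recursive_rel (\<lambda>n. P n \<or> Q n)"
proof -
  have "recursive_rel (\<lambda>n. \<not> (\<not> P n \<and> \<not> Q n))"
    by (intro recursive_rel_not recursive_rel_conj assms)
  then show ?thesis by simp
qed

lemma recursive_rel_imp:
  assumes "recursive_rel P" "recursive_rel Q"
  shows "recursive_rel (\<lambda>n. P n \<longrightarrow> Q n)"
  unfolding imp_conv_disj by (intro recursive_rel_disj recursive_rel_not assms)

lemma recursive_rel_bex:
  assumes h: "recursive_fun h" and P: "recursive_rel (\<lambda>z. P (pfst z) (psnd z))"
  shows "recursive_rel (\<lambda>n. \<exists>i<h n. P n i)"
proof -
  \<comment> \<open>Bounded search as a recursion: a hit sets the accumulator to 1, a miss keeps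
    it.\<close>
  have bex: "of_bool (\<exists>i<b. Q i) = rec_nat (0::nat) (\<lambda>i r. if Q i then Suc 0 else r) b" for b Q
  proof (induction b)
    case (Suc b)
    have "(\<exists>i<Suc b. Q i) \<longleftrightarrow> Q b \<or> (\<exists>i<b. Q i)" by (auto simp: less_Suc_eq)
    then show ?case using Suc by (cases "Q b") simp_all
  qed simp
  \<comment> \<open>The recursion step receives parameter, counter and accumulator; \<open>P\<close>
    is to see only the first two.\<close>
  have proj: "recursive_fun (\<lambda>z. prod_encode (pfst z, pfst (psnd z)))"
    by (intro recursive_basic)
  have "recursive_rel (\<lambda>z. P (pfst z) (pfst (psnd z)))"
    using recursive_fun_comp[OF P[unfolded recursive_rel_def] proj]
    by (simp add: recursive_rel_def)
  then show ?thesis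
    unfolding recursive_rel_def[of "\<lambda>n. \<exists>i<h n. P n i"] bex
    by (intro recursive_fun_rec_nat recursive_fun_if recursive_basic h)
qed

lemma recursive_rel_ball:
  assumes h: "recursive_fun h" and P: "recursive_rel (\<lambda>z. P (pfst z) (psnd z))"
  shows "recursive_rel (\<lambda>n. \<forall>i<h n. P n i)"
proof -
  have "recursive_rel (\<lambda>n. \<not> (\<exists>i<h n. \<not> P n i))"
    by (intro recursive_rel_not recursive_rel_bex assms)
  then show ?thesis by simp
qed

lemmas recursive_intros = recursive_basic recursive_fun_diff recursive_fun_add
  recursive_rel_eq recursive_rel_le recursive_rel_not recursive_rel_conj recursive_rel_disj
  recursive_rel_imp recursive_rel_bex recursive_rel_ball

section \<open>Coded lists\<close>

text \<open>Positions are handled through suffixes: the empty list has code 0, so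
  \<open>ldrop i l \<noteq> 0\<close> says that \<open>i\<close> is a valid index, and
  \<open>lhd (ldrop i l)\<close> is then the entry there.\<close>

definition ldrop :: "nat \<Rightarrow> nat \<Rightarrow> nat" where
  "ldrop i l = list_encode (drop i (list_decode l))"

text \<open>A nonempty list is coded as the successor of a pair, hence \<open>l - 1\<close>.\<close>

definition lhd :: "nat \<Rightarrow> nat" where "lhd l = pfst (l - 1)"
definition ltl :: "nat \<Rightarrow> nat" where "ltl l = psnd (l - 1)"

lemma lhd_list_encode [simp]: "lhd (list_encode (x # xs)) = x"
  by (simp add: lhd_def)

lemma ltl_list_encode [simp]: "ltl (list_encode xs) = list_encode (tl xs)"
proof (cases xs)
  case Nil
  \<comment> \<open>Truncated subtraction sends the code 0 of the empty list to 0, which codes the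
    pair of zeros; thus 0 is its own tail.\<close>
  have "prod_encode (0, 0) = 0" by (simp add: prod_encode_def)
  then have "psnd 0 = 0" by (metis psnd_prod_encode)
  with Nil show ?thesis by (simp add: ltl_def)
qed (simp add: ltl_def)

lemma list_encode_eq_0_iff [simp]: "list_encode xs = 0 \<longleftrightarrow> xs = []"
  by (cases xs) simp_all

lemma ldrop_eq_0_iff [simp]: "ldrop i (list_encode xs) = 0 \<longleftrightarrow> length xs \<le> i"
  by (simp add: ldrop_def)

lemma lhd_ldrop [simp]: "i < length xs \<Longrightarrow> lhd (ldrop i (list_encode xs)) = xs ! i"
  by (metis Cons_nth_drop_Suc ldrop_def lhd_list_encode list_encode_inverse)

lemma ltl_ldrop [simp]: "ltl (ldrop i (list_encode xs)) = list_encode (drop (Suc i) xs)"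
  by (simp add: ldrop_def drop_Suc tl_drop)

text \<open>Quantifiers over positions can hence be bounded by the code itself, which keeps list
  predicates recursive.\<close>

lemma length_le_list_encode: "length xs \<le> list_encode xs"
proof (induction xs)
  case (Cons x xs)
  then show ?case using le_prod_encode_2[of "list_encode xs" x] by simp
qed simp

lemma mem_less_list_encode: "x \<in> set xs \<Longrightarrow> x < list_encode xs"
proof (induction xs)
  case (Cons y xs)
  then show ?case
    using le_prod_encode_2[of "list_encode xs" y] le_prod_encode_1[of y "list_encode xs"] by auto
qed simp

lemma recursive_fun_lhd: "recursive_fun f \<Longrightarrow> recursive_fun (\<lambda>n. lhd (f n))"
  unfolding lhd_def by (intro recursive_intros)

lemma recursive_fun_ltl: "recursive_fun f \<Longrightarrow> recursive_fun (\<lambda>n. ltl (f n))"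
  unfolding ltl_def by (intro recursive_intros)

lemma recursive_fun_ldrop:
  assumes f: "recursive_fun f" and g: "recursive_fun g"
  shows "recursive_fun (\<lambda>n. ldrop (f n) (g n))"
proof -
  have "ldrop i l = rec_nat l (\<lambda>_ r. ltl r) i" for i l
  proof (induction i)
    case (Suc i)
    then show ?case
      by (metis (no_types, lifting) list_decode_inverse ltl_ldrop ldrop_def old.nat.simps(7))
  qed (simp add: ldrop_def)
  then show ?thesis
    by (simp only:) (intro recursive_basic recursive_fun_ltl f g)
qed

lemma list_decode_mem_iff:
  "z \<in> set (list_decode l) \<longleftrightarrow> (\<exists>i<l. ldrop i l \<noteq> 0 \<and> lhd (ldrop i l) = z)"
proof -
  obtain xs where l: "l = list_encode xs" by (metis list_decode_inverse)
  show ?thesis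
    unfolding l list_encode_inverse in_set_conv_nth ldrop_eq_0_iff
    using length_le_list_encode[of xs] by (metis lhd_ldrop not_le order_less_le_trans)
qed

lemma recursive_rel_list_mem:
  assumes f: "recursive_fun f" and g: "recursive_fun g"
  shows "recursive_rel (\<lambda>n. f n \<in> set (list_decode (g n)))"
  unfolding list_decode_mem_iff
  by (intro recursive_intros recursive_fun_lhd recursive_fun_ldrop recursive_fun_comp[OF f]
      recursive_fun_comp[OF g] f g)

section \<open>Prefixes of coded lists\<close>

definition lprefix :: "nat \<Rightarrow> nat \<Rightarrow> bool" where
  "lprefix t l \<longleftrightarrow> (\<forall>i<t. ldrop i t \<noteq> 0 \<longrightarrow> ldrop i l \<noteq> 0 \<and> lhd (ldrop i t) = lhd (ldrop i l))"

lemma lprefix_list_encode: "lprefix (list_encode xs) (list_encode ys) \<longleftrightarrow> prefix xs ys"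
proof
  assume *: "lprefix (list_encode xs) (list_encode ys)"
  have nth: "i < length ys \<and> xs ! i = ys ! i" if "i < length xs" for i
  proof -
    have "i < list_encode xs" using that length_le_list_encode[of xs] by simp
    then have "ldrop i (list_encode ys) \<noteq> 0"
      and eq: "lhd (ldrop i (list_encode xs)) = lhd (ldrop i (list_encode ys))"
      using * that unfolding lprefix_def by auto
    then have "i < length ys" by simp
    with that eq show ?thesis by simp
  qed
  \<comment> \<open>If \<open>ys\<close> were shorter, \<open>nth\<close> would fail at position
    \<open>length ys\<close>.\<close>
  then have "length xs \<le> length ys"
    by (meson linorder_not_less nat_less_le)
  moreover have "xs = take (length xs) ys"
    using nth calculation by (intro nth_equalityI) auto
  ultimately show "prefix xs ys"
    by (metis take_is_prefix)
next
  assume "prefix xs ys"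
  then show "lprefix (list_encode xs) (list_encode ys)"
    by (auto simp: lprefix_def prefix_def nth_append)
qed

lemma recursive_rel_lprefix:
  assumes f: "recursive_fun f" and g: "recursive_fun g"
  shows "recursive_rel (\<lambda>n. lprefix (f n) (g n))"
  unfolding lprefix_def
  by (intro recursive_intros recursive_fun_lhd recursive_fun_ldrop recursive_fun_comp[OF f]
      recursive_fun_comp[OF g] f g)

lemma prod_encode_mono2: "b \<le> b' \<Longrightarrow> prod_encode (a, b) \<le> prod_encode (a, b')"
  unfolding prod_encode_def triangle_def
  by (simp add: add_mono div_le_mono mult_le_mono)

text \<open>The code of the tail is the second component of the pair, in which Cantor pairing is
  monotone.\<close>

lemma list_encode_prefix_le: "prefix xs ys \<Longrightarrow> list_encode xs \<le> list_encode ys"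
proof (induction xs arbitrary: ys)
  case (Cons x xs)
  from Cons.prems obtain zs where "ys = x # zs" "prefix xs zs" by (cases ys) auto
  with Cons.IH show ?case by (simp add: prod_encode_mono2)
qed simp


section \<open>A universal evaluation relation\<close>

text \<open>
  A program is a number \<open>prod_encode (t, prod_encode (f, g))\<close>, where the tag \<open>t\<close> selects the scheme.
  Tag 7 is minimization. It calls tag 8, the search on \<open>prod_encode (a, k)\<close> that starts at \<open>k\<close>, so
  that every rule has finitely many premises.
\<close>

definition prog :: "nat \<Rightarrow> nat \<Rightarrow> nat \<Rightarrow> nat" where
  "prog t f g = prod_encode (t, prod_encode (f, g))"

definition tag :: "nat \<Rightarrow> nat" where "tag e = pfst e"
definition sub1 :: "nat \<Rightarrow> nat" where "sub1 e = pfst (psnd e)"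
definition sub2 :: "nat \<Rightarrow> nat" where "sub2 e = psnd (psnd e)"

lemma prog_sel [simp]: "tag (prog t f g) = t" "sub1 (prog t f g) = f" "sub2 (prog t f g) = g"
  by (simp_all add: prog_def tag_def sub1_def sub2_def)

text \<open>One application of the rules with premises taken from \<open>M\<close>. Keeping
  \<open>M\<close> abstract lets the same rules define \<open>evaluates\<close> and check a fact
  against a list.\<close>

definition eval_step :: "(nat \<Rightarrow> nat \<Rightarrow> nat \<Rightarrow> bool) \<Rightarrow> nat \<Rightarrow> nat \<Rightarrow> nat \<Rightarrow> bool" where
  "eval_step M e x y \<longleftrightarrow>
     tag e = 0 \<and> y = 0 \<or>
     tag e = 1 \<and> y = Suc x \<or>
     tag e = 2 \<and> y = pfst x \<or>
     tag e = 3 \<and> y = psnd x \<or>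
     tag e = 4 \<and> M (sub1 e) x (pfst y) \<and> M (sub2 e) x (psnd y) \<or>
     tag e = 5 \<and> (\<exists>v. M (sub2 e) x v \<and> M (sub1 e) v y) \<or>
     tag e = 6 \<and> psnd x = 0 \<and> M (sub1 e) (pfst x) y \<or>
     tag e = 6 \<and> psnd x \<noteq> 0 \<and> (\<exists>v. M e (prod_encode (pfst x, psnd x - 1)) v \<and>
       M (sub2 e) (prod_encode (pfst x, prod_encode (psnd x - 1, v))) y) \<or>
     tag e = 7 \<and> M (prog 8 (sub1 e) 0) (prod_encode (x, 0)) y \<or>
     tag e = 8 \<and> M (sub1 e) x 0 \<and> y = psnd x \<or>
     tag e = 8 \<and> (\<exists>v. M (sub1 e) x v \<and> v \<noteq> 0) \<and> M e (prod_encode (pfst x, Suc (psnd x))) y"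

lemma eval_step_mono [mono]:
  assumes "\<And>e x y. M e x y \<longrightarrow> N e x y"
  shows "eval_step M e x y \<longrightarrow> eval_step N e x y"
  unfolding eval_step_def by (intro imp_refl disj_mono conj_mono ex_mono assms)

inductive evaluates :: "nat \<Rightarrow> nat \<Rightarrow> nat \<Rightarrow> bool" where
  "eval_step evaluates e x y \<Longrightarrow> evaluates e x y"

lemma evaluates_iff: "evaluates e x y \<longleftrightarrow> eval_step evaluates e x y"
  by (rule iffI, erule evaluates.cases, simp, erule evaluates.intros)

lemma evaluates_prim:
  assumes "\<And>x y. evaluates e x y \<longleftrightarrow> f x = Some y" "\<And>x y. evaluates e' x y \<longleftrightarrow> g x = Some y"
  shows "evaluates (prog 6 e e') (prod_encode (a, k)) y \<longleftrightarrow> primrec_step f g a k = Some y"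
proof (induction k arbitrary: y)
  case 0
  show ?case by (subst evaluates_iff) (simp add: eval_step_def assms primrec_step_def)
next
  case (Suc k)
  have "primrec_step f g a (Suc k) = Some y \<longleftrightarrow>
      (\<exists>v. primrec_step f g a k = Some v \<and> g (prod_encode (a, prod_encode (k, v))) = Some y)"
    by (simp add: primrec_step_def bind_eq_Some_conv)
  then show ?case by (subst evaluates_iff) (simp add: eval_step_def assms Suc.IH)
qed

lemma evaluates_search:
  assumes f: "\<And>x y. evaluates e x y \<longleftrightarrow> f x = Some y"
  shows "evaluates (prog 8 e 0) (prod_encode (a, k)) y \<longleftrightarrow>
    k \<le> y \<and> f (prod_encode (a, y)) = Some 0 \<and>
    (\<forall>j. k \<le> j \<and> j < y \<longrightarrow> (\<exists>v. f (prod_encode (a, j)) = Some (Suc v)))"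
    (is "?L \<longleftrightarrow> ?R k")
proof
  \<comment> \<open>Rule induction on the evaluation, since the start \<open>k\<close> grows along
    the search; the equations retain the shape of program and argument.\<close>
  have "?R k" if "evaluates p x z" "p = prog 8 e 0" "x = prod_encode (a, k)" "z = y" for p x z k
    using that
  proof (induction arbitrary: k rule: evaluates.induct)
    case (1 p x z)
    from 1(1)[unfolded 1(2-4)]
    have "f (prod_encode (a, k)) = Some 0 \<and> y = k \<or>
        (\<exists>v. f (prod_encode (a, k)) = Some v \<and> v \<noteq> 0) \<and> ?R (Suc k)"
      by (simp add: eval_step_def f) blast
    then consider "f (prod_encode (a, k)) = Some 0" "y = k" |
      v where "f (prod_encode (a, k)) = Some (Suc v)" "?R (Suc k)"
      by (metis not0_implies_Suc)
    then show ?case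
    proof cases
      case 2
      moreover have "\<exists>v. f (prod_encode (a, j)) = Some (Suc v)" if "k \<le> j" "j < y" for j
        using 2 that by (cases "j = k") (auto simp: Suc_le_eq)
      ultimately show ?thesis by simp
    qed auto
  qed
  then show "?L \<Longrightarrow> ?R k" by blast
next
  assume R: "?R k"
  \<comment> \<open>Induction backwards from the result: \<open>d\<close> is the distance of the
    start from \<open>y\<close>.\<close>
  have "evaluates (prog 8 e 0) (prod_encode (a, y - d)) y" if "d \<le> y - k" for d
    using that
  proof (induction d)
    case 0
    show ?case by (subst evaluates_iff) (use R in \<open>simp add: eval_step_def f\<close>)
  next
    case (Suc d)
    then have le: "k \<le> y - Suc d" "y - Suc d < y" and eq: "Suc (y - Suc d) = y - d" by auto
    with R obtain v where "f (prod_encode (a, y - Suc d)) = Some (Suc v)" by blast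
    moreover have "evaluates (prog 8 e 0) (prod_encode (a, y - d)) y"
      using Suc by simp
    ultimately show ?case
      by (subst evaluates_iff) (simp add: eval_step_def f eq)
  qed
  from this[of "y - k"] R show ?L by simp
qed

text \<open>Positive values before \<open>y\<close> exclude an earlier zero, so \<open>y\<close> is
  the least zero and at most one \<open>y\<close> qualifies.\<close>

lemma minimization_eq_Some_iff:
  "minimization f a = Some y \<longleftrightarrow> f (prod_encode (a, y)) = Some 0 \<and>
    (\<forall>j<y. \<exists>v. f (prod_encode (a, j)) = Some (Suc v))" (is "_ \<longleftrightarrow> ?R y")
proof -
  have least: "(LEAST k. f (prod_encode (a, k)) = Some 0) = k" if "?R k" for k
  proof (rule Least_equality)
    fix j assume "f (prod_encode (a, j)) = Some 0"
    with that show "k \<le> j" by (cases "j < k") auto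
  qed (use that in simp)
  show ?thesis
  proof (cases "\<exists>k. ?R k")
    case True
    then obtain k where k: "?R k" by blast
    then have "minimization f a = Some k"
      unfolding minimization_def least[OF k] by (simp only: if_P[OF True])
    moreover have "y = k" if "?R y"
      using least[OF k] least[OF that] by (rule trans[OF sym, rotated])
    ultimately show ?thesis using k by auto
  next
    case False
    then have "minimization f a = None"
      unfolding minimization_def by (rule if_not_P)
    with False show ?thesis by simp
  qed
qed

text \<open>Induction on the construction of \<open>f\<close>: tags 0 to 7 match the eight schemes
  in turn.\<close>

lemma partial_recursive_program:
  assumes "partial_recursive f"
  obtains e where "\<And>x y. evaluates e x y \<longleftrightarrow> f x = Some y"
proof -
  have "\<exists>e. \<forall>x y. evaluates e x y \<longleftrightarrow> f x = Some y"
    using assms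
  proof induction
    case zero
    show ?case by (intro exI[of _ "prog 0 0 0"] allI, subst evaluates_iff) (auto simp: eval_step_def)
  next
    case succ
    show ?case by (intro exI[of _ "prog 1 0 0"] allI, subst evaluates_iff) (auto simp: eval_step_def)
  next
    case left
    show ?case by (intro exI[of _ "prog 2 0 0"] allI, subst evaluates_iff) (auto simp: eval_step_def pfst_def)
  next
    case right
    show ?case by (intro exI[of _ "prog 3 0 0"] allI, subst evaluates_iff) (auto simp: eval_step_def psnd_def)
  next
    case (pair f g)
    then obtain e e' where "\<forall>x y. evaluates e x y \<longleftrightarrow> f x = Some y"
      "\<forall>x y. evaluates e' x y \<longleftrightarrow> g x = Some y" by blast
    then show ?case
      by (intro exI[of _ "prog 4 e e'"] allI, subst evaluates_iff)
        (auto simp: eval_step_def bind_eq_Some_conv)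
  next
    case (comp f g)
    then obtain e e' where "\<forall>x y. evaluates e x y \<longleftrightarrow> f x = Some y"
      "\<forall>x y. evaluates e' x y \<longleftrightarrow> g x = Some y" by blast
    then show ?case
      by (intro exI[of _ "prog 5 e e'"] allI, subst evaluates_iff)
        (auto simp: eval_step_def bind_eq_Some_conv)
  next
    case (prim f g)
    then obtain e e' where "\<And>x y. evaluates e x y \<longleftrightarrow> f x = Some y"
      "\<And>x y. evaluates e' x y \<longleftrightarrow> g x = Some y" by blast
    note prim = evaluates_prim[of e f e' g, OF this]
    have "evaluates (prog 6 e e') x y \<longleftrightarrow>
        primrec_step f g (fst (prod_decode x)) (snd (prod_decode x)) = Some y" for x y
      using prim[of "fst (prod_decode x)" "snd (prod_decode x)"] by simp
    then show ?case by blast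
  next
    case (mini f)
    then obtain e where "\<And>x y. evaluates e x y \<longleftrightarrow> f x = Some y" by blast
    note search = evaluates_search[of e f, OF this]
    show ?case
      by (intro exI[of _ "prog 7 e 0"] allI, subst evaluates_iff)
        (simp add: eval_step_def search minimization_eq_Some_iff)
  qed
  with that show thesis by blast
qed

section \<open>Checking derivations\<close>

definition fact_code :: "nat \<Rightarrow> nat \<Rightarrow> nat \<Rightarrow> nat" where
  "fact_code e x y = prod_encode (e, prod_encode (x, y))"

fun derivation :: "nat list \<Rightarrow> bool" where
  "derivation [] \<longleftrightarrow> True"
| "derivation (z # zs) \<longleftrightarrow>
     eval_step (\<lambda>e x y. fact_code e x y \<in> set zs) (pfst z) (pfst (psnd z)) (psnd (psnd z)) \<and>
     derivation zs"

lemma derivation_sound: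
  "derivation zs \<Longrightarrow> fact_code e x y \<in> set zs \<Longrightarrow> evaluates e x y"
proof (induction zs arbitrary: e x y)
  case (Cons z zs)
  then have "evaluates (pfst z) (pfst (psnd z)) (psnd (psnd z))"
    by (subst evaluates_iff) (use Cons eval_step_mono in force)
  with Cons show ?case by (auto simp: fact_code_def)
qed simp

text \<open>Appending only enlarges the supply of premises, and \<open>eval_step\<close> is
  monotone. Derivations of several premises can thus be merged.\<close>

lemma derivation_append: "derivation xs \<Longrightarrow> derivation ys \<Longrightarrow> derivation (xs @ ys)"
proof (induction xs)
  case (Cons z xs)
  then show ?case
    using eval_step_mono[of "\<lambda>e x y. fact_code e x y \<in> set xs"
        "\<lambda>e x y. fact_code e x y \<in> set (xs @ ys)"]
    by auto
qed simp

definition derivable :: "nat \<Rightarrow> nat \<Rightarrow> nat \<Rightarrow> bool" where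
  "derivable e x y \<longleftrightarrow> (\<exists>zs. derivation zs \<and> fact_code e x y \<in> set zs)"

text \<open>No rule has more than two premises: append their derivations and put the conclusion in
  front.\<close>

lemma derivable_closed:
  assumes "eval_step derivable e x y"
  shows "derivable e x y"
proof -
  have *: "derivable e x y"
    if "derivation zs" "eval_step (\<lambda>e x y. fact_code e x y \<in> set zs) e x y" for zs
    unfolding derivable_def
    by (rule exI[of _ "fact_code e x y # zs"]) (use that in \<open>simp add: fact_code_def\<close>)
  let ?in = "\<lambda>zs e x y. fact_code e x y \<in> set zs"
  have no_premise: "derivable e x y" if "eval_step (?in []) e x y"
    using *[of "[]"] that by simp
  have one_premise: "derivable e x y"
    if "derivable p a b" and "\<And>zs. ?in zs p a b \<Longrightarrow> eval_step (?in zs) e x y" for p a b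
    using that(1) unfolding derivable_def[of p] by (blast intro: * that(2))
  have two_premises: "derivable e x y"
    if "derivable p a b" "derivable q c d"
      and "\<And>zs. ?in zs p a b \<Longrightarrow> ?in zs q c d \<Longrightarrow> eval_step (?in zs) e x y" for p a b q c d
  proof -
    from that(1,2) obtain zs zs' where "derivation zs" "derivation zs'" "?in zs p a b" "?in zs' q c d"
      unfolding derivable_def by blast
    then show ?thesis
      by (intro *[of "zs @ zs'"] derivation_append that(3)) simp_all
  qed
  from assms show ?thesis
    unfolding eval_step_def[of derivable]
  \<comment> \<open>The goals follow the disjuncts of \<open>eval_step\<close>; the first four have
    no premise and are closed at the end.\<close>
  proof (elim disjE conjE exE, goal_cases)
    case 5
    show ?case by (rule two_premises[OF 5(2,3)]) (simp add: eval_step_def 5(1))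
  next
    case (6 v)
    show ?case by (rule two_premises[OF 6(2,3)]) (simp add: eval_step_def 6(1), blast)
  next
    case 7
    show ?case by (rule one_premise[OF 7(3)]) (simp add: eval_step_def 7(1,2))
  next
    case (8 v)
    show ?case by (rule two_premises[OF 8(3,4)]) (use 8(2) in \<open>simp add: eval_step_def 8(1), blast\<close>)
  next
    case 9
    show ?case by (rule one_premise[OF 9(2)]) (simp add: eval_step_def 9(1))
  next
    case 10
    show ?case by (rule one_premise[OF 10(2)]) (simp add: eval_step_def 10(1,3))
  next
    case (11 v)
    show ?case
      by (rule two_premises[OF 11(3,2)]) (use 11(4) in \<open>simp add: eval_step_def 11(1), blast\<close>)
  qed (rule no_premise; simp add: eval_step_def)+
qed

lemma evaluates_iff_derivation:
  "evaluates e x y \<longleftrightarrow> (\<exists>zs. derivation zs \<and> fact_code e x y \<in> set zs)"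
proof
  assume "evaluates e x y"
  then have "derivable e x y"
  proof induction
    case (1 e x y)
    \<comment> \<open>Rule induction supplies \<open>eval_step\<close> of the conjunction of
      \<open>evaluates\<close> and \<open>derivable\<close>; monotonicity weakens it to
      \<open>derivable\<close>.\<close>
    show ?case
      by (rule derivable_closed, rule eval_step_mono[THEN mp, OF _ 1]) simp
  qed
  then show "\<exists>zs. derivation zs \<and> fact_code e x y \<in> set zs"
    by (simp add: derivable_def)
qed (blast intro: derivation_sound)


text \<open>Recursion over the list becomes a condition on each position, ready to be a bounded
  quantifier over the code.\<close>

lemma derivation_iff_nth:
  "derivation zs \<longleftrightarrow> (\<forall>i<length zs. eval_step (\<lambda>e x y. fact_code e x y \<in> set (drop (Suc i) zs))
     (pfst (zs ! i)) (pfst (psnd (zs ! i))) (psnd (psnd (zs ! i))))"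
proof (induction zs)
  case (Cons z zs)
  show ?case
    unfolding derivation.simps Cons.IH length_Cons All_less_Suc2 nth_Cons_0 nth_Cons_Suc
      drop_Suc_Cons drop_0 ..
qed simp

lemma derivation_list_decode_iff:
  "derivation (list_decode d) \<longleftrightarrow> (\<forall>i<d. ldrop i d \<noteq> 0 \<longrightarrow>
     eval_step (\<lambda>e x y. fact_code e x y \<in> set (list_decode (ltl (ldrop i d))))
       (pfst (lhd (ldrop i d))) (pfst (psnd (lhd (ldrop i d)))) (psnd (psnd (lhd (ldrop i d)))))"
    (is "_ \<longleftrightarrow> (\<forall>i<d. ldrop i d \<noteq> 0 \<longrightarrow> ?E i d)")
proof -
  obtain zs where d: "d = list_encode zs" by (metis list_decode_inverse)
  have "(\<forall>i<d. ldrop i d \<noteq> 0 \<longrightarrow> ?E i d) \<longleftrightarrow> (\<forall>i<length zs. ?E i d)"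
    unfolding d ldrop_eq_0_iff using length_le_list_encode[of zs] by (meson not_le order_less_le_trans)
  then show ?thesis
    unfolding derivation_iff_nth d by simp
qed

lemma recursive_fun_fact_code:
  "recursive_fun e \<Longrightarrow> recursive_fun x \<Longrightarrow> recursive_fun y \<Longrightarrow>
    recursive_fun (\<lambda>n. fact_code (e n) (x n) (y n))"
  unfolding fact_code_def by (intro recursive_intros)

text \<open>A value recorded in a listed fact is at most the code of that fact, which is below
  \<open>d\<close>. This bounds the search for the intermediate values in
  \<open>eval_step\<close>.\<close>

lemma bounded_fact_value:
  "(\<exists>v. fact_code e x v \<in> set (list_decode d) \<and> Q v) \<longleftrightarrow>
    (\<exists>v<d. fact_code e x v \<in> set (list_decode d) \<and> Q v)"
proof -
  have "v < d" if "fact_code e x v \<in> set (list_decode d)" for v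
  proof -
    have "v \<le> fact_code e x v"
      unfolding fact_code_def using le_prod_encode_2 order_trans by blast
    also have "\<dots> < d"
      using mem_less_list_encode[OF that] by simp
    finally show ?thesis .
  qed
  then show ?thesis by blast
qed

lemma recursive_rel_eval_step:
  assumes d: "recursive_fun d" and e: "recursive_fun e"
    and x: "recursive_fun x" and y: "recursive_fun y"
  shows "recursive_rel (\<lambda>n. eval_step (\<lambda>e x y. fact_code e x y \<in> set (list_decode (d n)))
    (e n) (x n) (y n))"
  unfolding eval_step_def bounded_fact_value tag_def sub1_def sub2_def prog_def
  by (intro recursive_intros recursive_rel_list_mem recursive_fun_fact_code
      recursive_fun_comp[OF d] recursive_fun_comp[OF e] recursive_fun_comp[OF x]
      recursive_fun_comp[OF y] d e x y)

text \<open>The analogue of Kleene's T predicate: a recursive relation whose projection along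
  \<open>d\<close> is \<open>evaluates\<close>.\<close>

definition evaluates_in :: "nat \<Rightarrow> nat \<Rightarrow> nat \<Rightarrow> nat \<Rightarrow> bool" where
  "evaluates_in d e x y \<longleftrightarrow> derivation (list_decode d) \<and> fact_code e x y \<in> set (list_decode d)"

lemma evaluates_iff_evaluates_in: "evaluates e x y \<longleftrightarrow> (\<exists>d. evaluates_in d e x y)"
  unfolding evaluates_iff_derivation evaluates_in_def by (metis list_encode_inverse)

lemma recursive_rel_evaluates_in:
  assumes d: "recursive_fun d" and e: "recursive_fun e"
    and x: "recursive_fun x" and y: "recursive_fun y"
  shows "recursive_rel (\<lambda>n. evaluates_in (d n) (e n) (x n) (y n))"
  unfolding evaluates_in_def derivation_list_decode_iff
  by (intro recursive_intros recursive_rel_list_mem recursive_fun_fact_code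
      recursive_rel_eval_step recursive_fun_ldrop recursive_fun_lhd recursive_fun_ltl
      recursive_fun_comp[OF d] d e x y)

section \<open>Randomness and membership as one recursive matrix\<close>

text \<open>\<open>string_code\<close> is not surjective, and a program for a machine is
  unconstrained off its range, so genuine inputs must be recognised.\<close>

definition lbits :: "nat \<Rightarrow> bool" where
  "lbits q \<longleftrightarrow> (\<forall>i<q. ldrop i q \<noteq> 0 \<longrightarrow> lhd (ldrop i q) \<le> 1)"

lemma lbits_iff: "lbits q \<longleftrightarrow> (\<exists>\<sigma>. q = string_code \<sigma>)"
proof -
  obtain xs where q: "q = list_encode xs" by (metis list_decode_inverse)
  have "lbits q \<longleftrightarrow> (\<forall>x\<in>set xs. x \<le> 1)"
  proof -
    have "lbits q \<longleftrightarrow> (\<forall>i<length xs. xs ! i \<le> 1)"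
      unfolding lbits_def q ldrop_eq_0_iff
      using length_le_list_encode[of xs] by (metis lhd_ldrop not_le order_less_le_trans)
    then show ?thesis by (simp only: all_set_conv_all_nth)
  qed
  also have "\<dots> \<longleftrightarrow> (\<exists>\<sigma>. xs = map of_bool \<sigma>)"
  proof
    assume "\<forall>x\<in>set xs. x \<le> 1"
    then have "xs = map of_bool (map (\<lambda>x. x = 1) xs)"
      by (induction xs) auto
    then show "\<exists>\<sigma>. xs = map of_bool \<sigma>" ..
  qed auto
  finally show ?thesis
    by (simp add: q string_code_def list_encode_eq)
qed

section \<open>Codes of strings and of initial segments\<close>

lemma string_code_eq_iff: "string_code \<sigma> = string_code \<tau> \<longleftrightarrow> \<sigma> = \<tau>"
proof -
  have "inj (of_bool :: bool \<Rightarrow> nat)" by (auto simp: inj_def)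
  then show ?thesis by (simp add: string_code_def list_encode_eq)
qed

lemma lprefix_string_code_iff:
  "lprefix t (string_code \<tau>) \<longleftrightarrow> (\<exists>\<sigma>. prefix \<sigma> \<tau> \<and> t = string_code \<sigma>)"
proof
  assume *: "lprefix t (string_code \<tau>)"
  obtain xs where t: "t = list_encode xs" by (metis list_decode_inverse)
  from * have "prefix xs (map of_bool \<tau>)"
    unfolding t string_code_def lprefix_list_encode .
  then have "xs = map of_bool (take (length xs) \<tau>)"
    by (metis append_eq_conv_conj prefix_def take_map)
  then show "\<exists>\<sigma>. prefix \<sigma> \<tau> \<and> t = string_code \<sigma>"
    unfolding t string_code_def by (metis take_is_prefix)
next
  assume "\<exists>\<sigma>. prefix \<sigma> \<tau> \<and> t = string_code \<sigma>"
  then show "lprefix t (string_code \<tau>)"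
    by (auto simp: string_code_def lprefix_list_encode map_mono_prefix)
qed

lemma string_code_prefix_le: "prefix \<sigma> \<tau> \<Longrightarrow> string_code \<sigma> \<le> string_code \<tau>"
  unfolding string_code_def by (intro list_encode_prefix_le map_mono_prefix)

lemma length_restr [simp]: "length (X \<restriction> n) = n"
  by (simp add: restr_def)

lemma prefix_restr_iff: "prefix \<sigma> (X \<restriction> n) \<longleftrightarrow> (\<exists>k\<le>n. \<sigma> = X \<restriction> k)"
proof
  assume p: "prefix \<sigma> (X \<restriction> n)"
  then have "length \<sigma> \<le> n" using prefix_length_le by fastforce
  moreover have "\<sigma> = X \<restriction> length \<sigma>"
  proof -
    have "\<sigma> = take (length \<sigma>) (X \<restriction> n)"
      using p by (metis append_eq_conv_conj prefix_def)
    with \<open>length \<sigma> \<le> n\<close> show ?thesis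
      by (simp add: restr_def take_map)
  qed
  ultimately show "\<exists>k\<le>n. \<sigma> = X \<restriction> k" by blast
next
  assume "\<exists>k\<le>n. \<sigma> = X \<restriction> k"
  then obtain k where "k \<le> n" "\<sigma> = X \<restriction> k" by blast
  then have "\<sigma> = take k (X \<restriction> n)"
    by (simp add: restr_def take_map)
  then show "prefix \<sigma> (X \<restriction> n)" by (simp add: take_is_prefix)
qed

lemma le_string_code_restr: "n \<le> string_code (X \<restriction> n)"
  using length_le_list_encode[of "map of_bool (X \<restriction> n)"] by (simp add: string_code_def)

text \<open>The infimum of a nonempty set of \<open>enat\<close> is attained, and without
  descriptions it is infinite.\<close>

lemma K_plus_less_iff:
  "K U \<tau> + enat c < enat n \<longleftrightarrow> (\<exists>\<sigma>. U \<sigma> = Some \<tau> \<and> length \<sigma> + c < n)"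
proof
  assume less: "K U \<tau> + enat c < enat n"
  let ?L = "(\<lambda>\<sigma>. enat (length \<sigma>)) ` {\<sigma>. U \<sigma> = Some \<tau>}"
  have "?L \<noteq> {}"
  proof
    assume "?L = {}"
    then have "K U \<tau> = \<infinity>" by (simp add: K_def top_enat_def)
    with less show False by simp
  qed
  then have "K U \<tau> \<in> ?L"
    unfolding K_def Inf_enat_def by (auto intro: LeastI)
  then obtain \<sigma> where "U \<sigma> = Some \<tau>" "K U \<tau> = enat (length \<sigma>)" by blast
  with less show "\<exists>\<sigma>. U \<sigma> = Some \<tau> \<and> length \<sigma> + c < n" by auto
next
  assume "\<exists>\<sigma>. U \<sigma> = Some \<tau> \<and> length \<sigma> + c < n"
  then obtain \<sigma> where \<sigma>: "U \<sigma> = Some \<tau>" "length \<sigma> + c < n" by blast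
  then have "K U \<tau> \<le> enat (length \<sigma>)"
    unfolding K_def by (intro INF_lower) simp
  then have "K U \<tau> + enat c \<le> enat (length \<sigma> + c)"
    by (metis add_right_mono plus_enat_simps(1))
  with \<sigma>(2) show "K U \<tau> + enat c < enat n"
    by (metis enat_ord_simps(2) order_le_less_trans)
qed

text \<open>One short description witnesses failure of randomness, so for computable
  \<open>U\<close> the failure is recursively enumerable.\<close>

lemma ml_random_const_iff:
  "ml_random_const U c X \<longleftrightarrow> \<not> (\<exists>k \<sigma>. U \<sigma> = Some (X \<restriction> k) \<and> length \<sigma> + c < k)"
  unfolding ml_random_const_def using K_plus_less_iff by (metis not_le)

text \<open>
  \<open>d\<close> packs a description \<open>q\<close> of \<open>t\<close>, a derivation of \<open>U q = t\<close> and a bound \<open>i\<close> with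
  \<open>length q \<le> i\<close> and \<open>i + c < length t\<close>.
\<close>

definition compresses :: "nat \<Rightarrow> nat \<Rightarrow> nat \<Rightarrow> nat \<Rightarrow> bool" where
  "compresses u c t d \<longleftrightarrow> lbits (pfst d) \<and> evaluates_in (pfst (psnd d)) u (pfst d) t \<and>
     ldrop (psnd (psnd d)) (pfst d) = 0 \<and> ldrop (psnd (psnd d) + c) t \<noteq> 0"

text \<open>Output 0 encodes falsity of the matrix. Accordingly \<open>d\<close> is either packed
  evidence of compression or a derivation of that output.\<close>

definition refutes :: "nat \<Rightarrow> nat \<Rightarrow> nat \<Rightarrow> nat \<Rightarrow> nat \<Rightarrow> nat \<Rightarrow> bool" where
  "refutes u c e m t d \<longleftrightarrow> compresses u c t d \<or> evaluates_in d e (prod_encode (t, m)) 0"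

text \<open>
  Every quantifier is bounded by the code of the initial segment read. The code dominates the
  codes of its prefixes and the length, so each refutation is found eventually.
\<close>

definition unrefuted :: "nat \<Rightarrow> nat \<Rightarrow> nat \<Rightarrow> nat \<Rightarrow> nat \<Rightarrow> bool" where
  "unrefuted u c e m l \<longleftrightarrow> \<not> (\<exists>t<Suc l. lprefix t l \<and> (\<exists>d<l. refutes u c e m t d))"

text \<open>Only an actual output 0 rejects. Divergence counts as acceptance, so every number
  \<open>e\<close> indexes a class.\<close>

definition survives :: "nat \<Rightarrow> nat \<Rightarrow> real_seq \<Rightarrow> bool" where
  "survives e m X \<longleftrightarrow> (\<forall>k. \<not> evaluates e (prod_encode (string_code (X \<restriction> k), m)) 0)"

lemma recursive_rel_unrefuted:
  assumes c: "recursive_fun c" and e: "recursive_fun e" and m: "recursive_fun m"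
    and l: "recursive_fun l"
  shows "recursive_rel (\<lambda>n. unrefuted u (c n) (e n) (m n) (l n))"
  unfolding unrefuted_def refutes_def compresses_def lbits_def
  by (intro recursive_intros recursive_rel_lprefix recursive_rel_evaluates_in recursive_fun_ldrop
      recursive_fun_lhd recursive_fun_comp[OF c] recursive_fun_comp[OF e] recursive_fun_comp[OF m]
      recursive_fun_comp[OF l] c e m l)

text \<open>A refutation found from a string is found from each extension too, since prefixes are
  inherited and both bounds grow with the code. The unrefuted strings therefore form a tree.\<close>

lemma unrefuted_prefix:
  assumes "prefix \<sigma> \<tau>" "unrefuted u c e m (string_code \<tau>)"
  shows "unrefuted u c e m (string_code \<sigma>)"
proof -
  have "t < Suc (string_code \<tau>) \<and> lprefix t (string_code \<tau>)"
    if "t < Suc (string_code \<sigma>)" "lprefix t (string_code \<sigma>)" for t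
    using that string_code_prefix_le[OF assms(1)] prefix_order.trans[OF _ assms(1)]
    unfolding lprefix_string_code_iff by auto
  with assms(2) show ?thesis
    unfolding unrefuted_def using string_code_prefix_le[OF assms(1)]
    by (meson order_less_le_trans)
qed

lemma unrefuted_restr_iff:
  "(\<forall>n. unrefuted u c e m (string_code (X \<restriction> n))) \<longleftrightarrow>
    \<not> (\<exists>k d. refutes u c e m (string_code (X \<restriction> k)) d)"
proof -
  have "\<exists>n. \<not> unrefuted u c e m (string_code (X \<restriction> n))"
    if r: "refutes u c e m (string_code (X \<restriction> k)) d" for k d
  proof -
    \<comment> \<open>At least \<open>k\<close> bits, so that the refuted segment is a prefix, and
      more than \<open>d\<close>, so that the code strictly exceeds \<open>d\<close>.\<close>
    let ?n = "max k (Suc d)"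
    have p: "prefix (X \<restriction> k) (X \<restriction> ?n)" unfolding prefix_restr_iff by (intro exI[of _ k]) simp
    have "d < string_code (X \<restriction> ?n)" using le_string_code_restr[of ?n X] by simp
    with r p string_code_prefix_le[OF p]
    have "\<not> unrefuted u c e m (string_code (X \<restriction> ?n))"
      unfolding unrefuted_def lprefix_string_code_iff by (auto simp: less_Suc_eq_le)
    then show ?thesis ..
  qed
  moreover have "\<exists>k d. refutes u c e m (string_code (X \<restriction> k)) d"
    if "\<not> unrefuted u c e m (string_code (X \<restriction> n))" for n
    using that unfolding unrefuted_def lprefix_string_code_iff prefix_restr_iff by auto
  ultimately show ?thesis by meson
qed

lemma compresses_iff:
  assumes u: "\<And>x y. evaluates u x y \<longleftrightarrow> f x = Some y"
    and f: "\<And>\<sigma>. f (string_code \<sigma>) = map_option string_code (U \<sigma>)"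
  shows "(\<exists>d. compresses u c (string_code \<tau>) d) \<longleftrightarrow> (\<exists>\<sigma>. U \<sigma> = Some \<tau> \<and> length \<sigma> + c < length \<tau>)"
proof
  assume "\<exists>d. compresses u c (string_code \<tau>) d"
  then obtain d \<sigma> where d: "compresses u c (string_code \<tau>) d" and \<sigma>: "pfst d = string_code \<sigma>"
    unfolding compresses_def lbits_iff by blast
  then have "evaluates u (string_code \<sigma>) (string_code \<tau>)"
    unfolding compresses_def evaluates_iff_evaluates_in by auto
  then have "U \<sigma> = Some \<tau>"
    by (auto simp: u f string_code_eq_iff)
  moreover have "length \<sigma> + c < length \<tau>"
    using d unfolding compresses_def \<sigma> by (simp add: string_code_def)
  ultimately show "\<exists>\<sigma>. U \<sigma> = Some \<tau> \<and> length \<sigma> + c < length \<tau>" by blast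
next
  assume "\<exists>\<sigma>. U \<sigma> = Some \<tau> \<and> length \<sigma> + c < length \<tau>"
  then obtain \<sigma> where \<sigma>: "U \<sigma> = Some \<tau>" "length \<sigma> + c < length \<tau>" by blast
  then have "evaluates u (string_code \<sigma>) (string_code \<tau>)" by (simp add: u f)
  then obtain s where "evaluates_in s u (string_code \<sigma>) (string_code \<tau>)"
    unfolding evaluates_iff_evaluates_in ..
  moreover have "lbits (string_code \<sigma>)" unfolding lbits_iff by blast
  moreover have "ldrop (length \<sigma>) (string_code \<sigma>) = 0" "ldrop (length \<sigma> + c) (string_code \<tau>) \<noteq> 0"
    using \<sigma>(2) by (simp_all add: string_code_def)
  \<comment> \<open>The length of \<open>\<sigma>\<close> itself serves as the bound.\<close>
  ultimately have
    "compresses u c (string_code \<tau>) (prod_encode (string_code \<sigma>, prod_encode (s, length \<sigma>)))"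
    unfolding compresses_def by simp
  then show "\<exists>d. compresses u c (string_code \<tau>) d" ..
qed

text \<open>The two kinds of refutation separate: compressions defeat randomness with constant
  \<open>c\<close>, outputs 0 defeat survival.\<close>

lemma unrefuted_iff:
  assumes "\<And>x y. evaluates u x y \<longleftrightarrow> f x = Some y"
    and "\<And>\<sigma>. f (string_code \<sigma>) = map_option string_code (U \<sigma>)"
  shows "(\<forall>n. unrefuted u c e m (string_code (X \<restriction> n))) \<longleftrightarrow>
    ml_random_const U c X \<and> survives e m X"
proof -
  have "(\<exists>k d. compresses u c (string_code (X \<restriction> k)) d) \<longleftrightarrow> \<not> ml_random_const U c X"
    by (simp only: compresses_iff[OF assms] ml_random_const_iff length_restr not_not)
  moreover have "(\<exists>k d. evaluates_in d e (prod_encode (string_code (X \<restriction> k), m)) 0) \<longleftrightarrow>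
      \<not> survives e m X"
    unfolding survives_def evaluates_iff_evaluates_in by simp
  ultimately show ?thesis
    unfolding unrefuted_restr_iff refutes_def ex_disj_distrib by simp
qed

lemma survives_iff:
  assumes "\<And>x y. evaluates e x y \<longleftrightarrow> f x = Some y"
    and "\<And>\<sigma>. f (prod_encode (string_code \<sigma>, m)) = Some (of_bool (R \<sigma>))"
  shows "survives e m X \<longleftrightarrow> (\<forall>n. R (X \<restriction> n))"
  unfolding survives_def assms by simp

section \<open>Universal matrices and the two enumerations\<close>

lemma computable_predI:
  assumes "recursive_rel Q" "\<And>x. P x \<longleftrightarrow> Q (enc x)"
  shows "computable_pred enc P"
  unfolding computable_pred_def
  using assms(1)[unfolded recursive_rel_def recursive_fun_def] assms(2) by auto

lemma universal_Pi01:
  assumes "Pi01_class P"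
  obtains e where "P = {X. survives e 0 X}"
proof -
  from assms obtain T f where P: "P = paths T" and "partial_recursive f"
    and f: "\<And>\<sigma>. f (string_code \<sigma>) = Some (of_bool (\<sigma> \<in> T))"
    unfolding Pi01_class_def computable_tree_def computable_pred_def by blast
  \<comment> \<open>The decider of \<open>T\<close> reads the string alone; the left projection
    removes the parameter that \<open>survives\<close> adds.\<close>
  then have "partial_recursive (\<lambda>n. Option.bind (Some (fst (prod_decode n))) f)"
    by (intro partial_recursive.comp partial_recursive.left)
  then obtain e where
    e: "\<And>x y. evaluates e x y \<longleftrightarrow> Option.bind (Some (fst (prod_decode x))) f = Some y"
    using partial_recursive_program by blast
  have "survives e 0 X \<longleftrightarrow> (\<forall>n. X \<restriction> n \<in> T)" for X
    by (rule survives_iff[OF e]) (simp add: f)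
  then show thesis
    by (intro that[of e]) (simp add: P paths_def)
qed

text \<open>The outer existential witness of the class becomes the parameter of a program for the
  matrix.\<close>

lemma universal_Sigma02:
  assumes "Sigma02_class A"
  obtains e where "A = {X. \<exists>m. survives e m X}"
proof -
  from assms obtain R f where A: "A = {X. \<exists>m. \<forall>n. R (X \<restriction> n, m)}" and "partial_recursive f"
    and f: "\<And>\<sigma> m. f (prod_encode (string_code \<sigma>, m)) = Some (of_bool (R (\<sigma>, m)))"
    unfolding Sigma02_class_def computable_pred_def by auto
  then obtain e where e: "\<And>x y. evaluates e x y \<longleftrightarrow> f x = Some y"
    using partial_recursive_program by blast
  have "survives e m X \<longleftrightarrow> (\<forall>n. R (X \<restriction> n, m))" for m X
    by (rule survives_iff[OF e f])
  then show thesis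
    by (intro that[of e]) (simp add: A)
qed

theorem proposition19:
  fixes U :: "bool list \<Rightarrow> bool list option"
  assumes "universal_prefix_free_machine U"
  shows "(\<forall>c::nat. effectively_enumerable_Pi01
             {P. Pi01_class P \<and> (\<forall>X\<in>P. ml_random_const U c X)}) \<and>
         effectively_enumerable_Sigma02
             {A. Sigma02_class A \<and> (\<forall>X\<in>A. ml_random U X)}"
proof -
  from assms obtain f where "partial_recursive f"
    and f: "\<And>\<sigma>. f (string_code \<sigma>) = map_option string_code (U \<sigma>)"
    unfolding universal_prefix_free_machine_def prefix_free_machine_def partial_computable_def
    by blast
  then obtain u where u: "\<And>x y. evaluates u x y \<longleftrightarrow> f x = Some y"
    using partial_recursive_program by blast
  note unrefuted = unrefuted_iff[of u f U, OF u f]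

  have "effectively_enumerable_Pi01 {P. Pi01_class P \<and> (\<forall>X\<in>P. ml_random_const U c X)}" for c
  proof -
    let ?C = "\<lambda>e. {X. ml_random_const U c X \<and> survives e 0 X}"
    let ?S = "{(X, e). ml_random_const U c X \<and> survives e 0 X}"
    have "Pi01_set ?S"
      unfolding Pi01_set_def
    proof (intro exI conjI)
      let ?R = "\<lambda>(\<sigma>, e). unrefuted u c e 0 (string_code \<sigma>)"
      show "computable_pred (\<lambda>(\<sigma>, e). prod_encode (string_code \<sigma>, e)) ?R"
        by (rule computable_predI[where Q = "\<lambda>n. unrefuted u c (psnd n) 0 (pfst n)"])
          (intro recursive_rel_unrefuted recursive_basic, auto)
      show "?S = {(X, e). \<forall>n. ?R (X \<restriction> n, e)}"
        by (simp add: unrefuted)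
    qed
    moreover have "Pi01_class (?C e)" for e
      unfolding Pi01_class_def
    proof (intro exI conjI)
      \<comment> \<open>Its quantifiers are bounded, so this tree is computable for every
        \<open>e\<close>, even where program \<open>e\<close> diverges.\<close>
      let ?T = "{\<sigma>. unrefuted u c e 0 (string_code \<sigma>)}"
      have "computable_pred string_code (\<lambda>\<sigma>. \<sigma> \<in> ?T)"
        by (rule computable_predI[where Q = "\<lambda>n. unrefuted u c e 0 n"])
          (intro recursive_rel_unrefuted recursive_basic, simp)
      then show "computable_tree ?T"
        unfolding computable_tree_def using unrefuted_prefix by blast
      show "?C e = paths ?T"
        by (simp add: paths_def unrefuted)
    qed
    moreover have "P \<in> range ?C" if "Pi01_class P" "\<forall>X\<in>P. ml_random_const U c X" for P
    proof -
      from that(1) obtain e where "P = {X. survives e 0 X}" by (rule universal_Pi01)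
      with that(2) have "P = ?C e" by blast
      then show ?thesis by blast
    qed
    ultimately show ?thesis
      unfolding effectively_enumerable_Pi01_def
      by (intro exI[of _ ?S] conjI) auto
  qed
  moreover
  have "effectively_enumerable_Sigma02 {A. Sigma02_class A \<and> (\<forall>X\<in>A. ml_random U X)}"
  proof -
    \<comment> \<open>The randomness constant varies with \<open>X\<close>, so it joins the witness
      of the class: \<open>m\<close> codes both, contracting two existential quantifiers into
      one.\<close>
    let ?C = "\<lambda>e. {X. \<exists>m. ml_random_const U (pfst m) X \<and> survives e (psnd m) X}"
    let ?S = "{(X, e). \<exists>m. ml_random_const U (pfst m) X \<and> survives e (psnd m) X}"
    have "Sigma02_set ?S"
      unfolding Sigma02_set_def
    proof (intro exI conjI)
      let ?R = "\<lambda>(\<sigma>, m, e). unrefuted u (pfst m) e (psnd m) (string_code \<sigma>)"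
      show "computable_pred (\<lambda>(\<sigma>, m, e). prod_encode (string_code \<sigma>, prod_encode (m, e))) ?R"
        by (rule computable_predI[where Q = "\<lambda>n. unrefuted u (pfst (pfst (psnd n)))
              (psnd (psnd n)) (psnd (pfst (psnd n))) (pfst n)"])
          (intro recursive_rel_unrefuted recursive_basic, auto)
      show "?S = {(X, e). \<exists>m. \<forall>n. ?R (X \<restriction> n, m, e)}"
        by (simp add: unrefuted)
    qed
    moreover have "Sigma02_class (?C e)" for e
      unfolding Sigma02_class_def
    proof (intro exI conjI)
      let ?R = "\<lambda>(\<sigma>, m). unrefuted u (pfst m) e (psnd m) (string_code \<sigma>)"
      show "computable_pred (\<lambda>(\<sigma>, m). prod_encode (string_code \<sigma>, m)) ?R"
        by (rule computable_predI[where
              Q = "\<lambda>n. unrefuted u (pfst (psnd n)) e (psnd (psnd n)) (pfst n)"])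
          (intro recursive_rel_unrefuted recursive_basic, auto)
      show "?C e = {X. \<exists>m. \<forall>n. ?R (X \<restriction> n, m)}"
        by (simp add: unrefuted)
    qed
    moreover have "A \<in> range ?C" if "Sigma02_class A" "\<forall>X\<in>A. ml_random U X" for A
    proof -
      from that(1) obtain e where A: "A = {X. \<exists>m. survives e m X}" by (rule universal_Sigma02)
      have "A = ?C e"
      proof (intro set_eqI iffI)
        fix X assume "X \<in> A"
        with A that(2) obtain c m where "ml_random_const U c X" "survives e m X"
          unfolding ml_random_def by blast
        then show "X \<in> ?C e"
          by (intro CollectI exI[of _ "prod_encode (c, m)"]) simp
      qed (use A in blast)
      then show ?thesis by blast
    qed
    ultimately show ?thesis
      unfolding effectively_enumerable_Sigma02_def
      by (intro exI[of _ ?S] conjI) (auto simp: ml_random_def)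
  qed
  ultimately show ?thesis by blast
qed

end
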